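(* Every Boolean algebraic subshift is algebraically conjugate to a product of a full shift and a finite shift. That is, for every Boolean algebraic subshift $X$ there exist Boolean algebraic subshifts $Y$ and $Z$, with $Y$ a full shift $A^{\mathbb{Z}}$ over some finite alphabet $A$ and $Z$ a finite set, and an algebraic conjugacy $X \to Y \times Z$, where $Y\times Z$ carries the direct product Boolean algebra structure.
   Context: The shift map on $S^{\mathbb{Z}}$ is $\sigma(x)_i=x_{i+1}$; a subshift is a closed $\sigma$-invariant subset of $S^{\mathbb{Z}}$ for a finite alphabet $S$; the full shift over $A$ is $A^{\mathbb{Z}}$. The product $Y\times Z$ of subshifts over $A$ and $B$ is regarded as a subshift over $A\times B$. A block map is a continuous shift-commuting map between subshifts (for maps $X^n\to X$, $X^n$ carries the product topology and the diagonal shift); a conjugacy is a bijective block map. A Boolean algebraic subshift is a subshift $X \subset S^{\mathbb{Z}}$ equipped with a Boolean algebra structure whose operations ($\wedge,\vee$, complement, $1$, $0$) are block maps (not necessarily defined cellwise). A conjugacy that is also a Boolean algebra homomorphism is called algebraic. *)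

theory Defs
  imports "HOL-Analysis.Analysis"
begin

section \<open>Subshifts\<close>

definition shift :: "(int \<Rightarrow> 'a) \<Rightarrow> int \<Rightarrow> 'a" where
  "shift x = (\<lambda>i. x (i + 1))"

definition full_shift :: "'a set \<Rightarrow> (int \<Rightarrow> 'a) set" where
  "full_shift S = (UNIV \<rightarrow> S)"

definition shift_topology :: "'a set \<Rightarrow> (int \<Rightarrow> 'a) topology" where
  "shift_topology S = product_topology (\<lambda>_. discrete_topology S) UNIV"

text \<open>Invariance is meant for the \<open>\<int>\<close>-action, i.e. as an equality: a closed set with only
  \<open>shift ` X \<subseteq> X\<close> need not be closed under the inverse shift.\<close>

definition subshift :: "'a set \<Rightarrow> (int \<Rightarrow> 'a) set \<Rightarrow> bool" where
  "subshift S X \<longleftrightarrow> finite S \<and> closedin (shift_topology S) X \<and> shift ` X = X"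

abbreviation subshift_topology :: "'a set \<Rightarrow> (int \<Rightarrow> 'a) set \<Rightarrow> (int \<Rightarrow> 'a) topology" where
  "subshift_topology S X \<equiv> subtopology (shift_topology S) X"

definition block_map ::
  "'a set \<Rightarrow> (int \<Rightarrow> 'a) set \<Rightarrow> 'b set \<Rightarrow> (int \<Rightarrow> 'b) set \<Rightarrow> ((int \<Rightarrow> 'a) \<Rightarrow> int \<Rightarrow> 'b) \<Rightarrow> bool"
  where
  "block_map S X T Y f \<longleftrightarrow>
     continuous_map (subshift_topology S X) (subshift_topology T Y) f \<and>
     (\<forall>x\<in>X. f (shift x) = shift (f x))"

text \<open>Block maps \<open>X\<^sup>2 \<rightarrow> X\<close> (in curried form) and \<open>X\<^sup>0 \<rightarrow> X\<close>.  As \<open>X\<^sup>0\<close> is a single shift-fixed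
  point, the latter are exactly the shift-fixed points of \<open>X\<close>.\<close>

definition block_map2 ::
  "'a set \<Rightarrow> (int \<Rightarrow> 'a) set \<Rightarrow> ((int \<Rightarrow> 'a) \<Rightarrow> (int \<Rightarrow> 'a) \<Rightarrow> int \<Rightarrow> 'a) \<Rightarrow> bool" where
  "block_map2 S X g \<longleftrightarrow>
     continuous_map (prod_topology (subshift_topology S X) (subshift_topology S X))
       (subshift_topology S X) (\<lambda>(x, y). g x y) \<and>
     (\<forall>x\<in>X. \<forall>y\<in>X. g (shift x) (shift y) = shift (g x y))"

definition block_map0 :: "(int \<Rightarrow> 'a) set \<Rightarrow> (int \<Rightarrow> 'a) \<Rightarrow> bool" where
  "block_map0 X c \<longleftrightarrow> c \<in> X \<and> shift c = c"


section \<open>Boolean algebras with an explicit carrier\<close>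

record 'a bool_alg =
  carrier :: "'a set"
  meet :: "'a \<Rightarrow> 'a \<Rightarrow> 'a"
  join :: "'a \<Rightarrow> 'a \<Rightarrow> 'a"
  cmpl :: "'a \<Rightarrow> 'a"
  one :: "'a"
  zero :: "'a"

text \<open>The axioms are those of \<^locale>\<open>abstract_boolean_algebra\<close>, relativised to the carrier.
  The one-element algebra is allowed.\<close>

locale carrier_boolean_algebra =
  fixes B :: "'a bool_alg"
  assumes meet_closed: "\<lbrakk>x \<in> carrier B; y \<in> carrier B\<rbrakk> \<Longrightarrow> meet B x y \<in> carrier B"
    and join_closed: "\<lbrakk>x \<in> carrier B; y \<in> carrier B\<rbrakk> \<Longrightarrow> join B x y \<in> carrier B"
    and cmpl_closed: "x \<in> carrier B \<Longrightarrow> cmpl B x \<in> carrier B"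
    and one_closed: "one B \<in> carrier B"
    and zero_closed: "zero B \<in> carrier B"
    and meet_assoc: "\<lbrakk>x \<in> carrier B; y \<in> carrier B; z \<in> carrier B\<rbrakk>
      \<Longrightarrow> meet B (meet B x y) z = meet B x (meet B y z)"
    and join_assoc: "\<lbrakk>x \<in> carrier B; y \<in> carrier B; z \<in> carrier B\<rbrakk>
      \<Longrightarrow> join B (join B x y) z = join B x (join B y z)"
    and meet_commute: "\<lbrakk>x \<in> carrier B; y \<in> carrier B\<rbrakk> \<Longrightarrow> meet B x y = meet B y x"
    and join_commute: "\<lbrakk>x \<in> carrier B; y \<in> carrier B\<rbrakk> \<Longrightarrow> join B x y = join B y x"
    and meet_join_distrib: "\<lbrakk>x \<in> carrier B; y \<in> carrier B; z \<in> carrier B\<rbrakk>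
      \<Longrightarrow> meet B x (join B y z) = join B (meet B x y) (meet B x z)"
    and join_meet_distrib: "\<lbrakk>x \<in> carrier B; y \<in> carrier B; z \<in> carrier B\<rbrakk>
      \<Longrightarrow> join B x (meet B y z) = meet B (join B x y) (join B x z)"
    and meet_one: "x \<in> carrier B \<Longrightarrow> meet B x (one B) = x"
    and join_zero: "x \<in> carrier B \<Longrightarrow> join B x (zero B) = x"
    and meet_cmpl: "x \<in> carrier B \<Longrightarrow> meet B x (cmpl B x) = zero B"
    and join_cmpl: "x \<in> carrier B \<Longrightarrow> join B x (cmpl B x) = one B"

definition bool_alg_hom :: "'a bool_alg \<Rightarrow> 'b bool_alg \<Rightarrow> ('a \<Rightarrow> 'b) \<Rightarrow> bool" where
  "bool_alg_hom B C f \<longleftrightarrow>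
     f ` carrier B \<subseteq> carrier C \<and>
     (\<forall>x\<in>carrier B. \<forall>y\<in>carrier B. f (meet B x y) = meet C (f x) (f y)) \<and>
     (\<forall>x\<in>carrier B. \<forall>y\<in>carrier B. f (join B x y) = join C (f x) (f y)) \<and>
     (\<forall>x\<in>carrier B. f (cmpl B x) = cmpl C (f x)) \<and>
     f (one B) = one C \<and> f (zero B) = zero C"


section \<open>Boolean algebraic subshifts\<close>

definition boolean_algebraic_subshift :: "'a set \<Rightarrow> (int \<Rightarrow> 'a) bool_alg \<Rightarrow> bool" where
  "boolean_algebraic_subshift S X \<longleftrightarrow>
     subshift S (carrier X) \<and>
     carrier_boolean_algebra X \<and>
     block_map2 S (carrier X) (meet X) \<and>
     block_map2 S (carrier X) (join X) \<and>
     block_map S (carrier X) S (carrier X) (cmpl X) \<and>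
     block_map0 (carrier X) (one X) \<and>
     block_map0 (carrier X) (zero X)"

definition pair_seq :: "(int \<Rightarrow> 'a) \<Rightarrow> (int \<Rightarrow> 'b) \<Rightarrow> int \<Rightarrow> 'a \<times> 'b" where
  "pair_seq y z = (\<lambda>i. (y i, z i))"

text \<open>The direct product, with pairs of configurations read as configurations of pairs, so that
  the product of subshifts over \<open>A\<close> and \<open>B\<close> lives over \<open>A \<times> B\<close>.\<close>

definition prod_bool_alg ::
  "(int \<Rightarrow> 'a) bool_alg \<Rightarrow> (int \<Rightarrow> 'b) bool_alg \<Rightarrow> (int \<Rightarrow> 'a \<times> 'b) bool_alg" where
  "prod_bool_alg Y Z = \<lparr>
     carrier = {pair_seq y z |y z. y \<in> carrier Y \<and> z \<in> carrier Z},
     meet = (\<lambda>u v. pair_seq (meet Y (fst \<circ> u) (fst \<circ> v)) (meet Z (snd \<circ> u) (snd \<circ> v))),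
     join = (\<lambda>u v. pair_seq (join Y (fst \<circ> u) (fst \<circ> v)) (join Z (snd \<circ> u) (snd \<circ> v))),
     cmpl = (\<lambda>u. pair_seq (cmpl Y (fst \<circ> u)) (cmpl Z (snd \<circ> u))),
     one = pair_seq (one Y) (one Z),
     zero = pair_seq (zero Y) (zero Z)\<rparr>"

definition conjugacy ::
  "'a set \<Rightarrow> (int \<Rightarrow> 'a) set \<Rightarrow> 'b set \<Rightarrow> (int \<Rightarrow> 'b) set \<Rightarrow> ((int \<Rightarrow> 'a) \<Rightarrow> int \<Rightarrow> 'b) \<Rightarrow> bool"
  where
  "conjugacy S X T Y f \<longleftrightarrow> block_map S X T Y f \<and> bij_betw f X Y"

definition algebraic_conjugacy ::
  "'a set \<Rightarrow> (int \<Rightarrow> 'a) bool_alg \<Rightarrow> 'b set \<Rightarrow> (int \<Rightarrow> 'b) bool_alg \<Rightarrow>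
    ((int \<Rightarrow> 'a) \<Rightarrow> int \<Rightarrow> 'b) \<Rightarrow> bool" where
  "algebraic_conjugacy S X T Y f \<longleftrightarrow>
     conjugacy S (carrier X) T (carrier Y) f \<and> bool_alg_hom X Y f"

end

theory Submission
  imports Defs
begin

text \<open>
  The idea is duality: a compact Boolean algebra is the power set of its set of atoms, with the
  product topology, and the shift, being a continuous automorphism, acts on it by permuting the
  atoms.  A subshift is expansive, since its points are separated by the shifts of the single
  cell \<open>x 0\<close>, and expansiveness leaves room for only finitely many orbits of atoms.  An infinite orbit
  is a copy of \<open>\<int>\<close>, so \<open>k\<close> of them contribute the full shift over an alphabet with \<open>2\<^sup>k\<close> letters; the
  finite orbits together contribute a finite power set.

  The topological input is \<open>continuous_map_discrete_factors_finite\<close>: a continuous map from a compact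
  Boolean algebra to a discrete space factors through \<open>x \<mapsto> meet x c\<close> for some \<open>c\<close> that has
  only finitely many elements below it.  Applied to the cell \<open>x \<mapsto> x 0\<close> this yields a finite set
  of atoms whose shifts separate the points (\<open>finite_separating_set_of_atoms\<close>).  Conversely, every
  set of atoms is the set of all atoms below some element (\<open>set_of_atoms_realised\<close>), again by compactness.

  The conjugacy sends \<open>x\<close> to its itinerary: cell \<open>n\<close> records which atoms of a fixed finite set lie
  below \<open>x\<close> after these atoms have been shifted by \<open>-n\<close>.  Taking one atom from each infinite orbit of the
  separating set gives the factor \<open>Y\<close>, taking its atoms with finite orbits gives the factor \<open>Z\<close>.  Both factors
  inherit from the power set of the chosen atoms an algebra structure that is computed cell by cell;
  that itineraries respect the operations is the primality of atoms.  Separation makes the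
  conjugacy injective, and realisability makes \<open>Y\<close> full and the conjugacy surjective.
\<close>

section \<open>Order and atoms in a Boolean algebra\<close>

context carrier_boolean_algebra
begin

definition le :: "'a \<Rightarrow> 'a \<Rightarrow> bool" where
  "le x y \<longleftrightarrow> meet B x y = x"

definition atom :: "'a \<Rightarrow> bool" where
  "atom a \<longleftrightarrow> a \<in> carrier B \<and> a \<noteq> zero B \<and>
     (\<forall>x\<in>carrier B. meet B a x = zero B \<or> meet B a x = a)"

lemmas closed = meet_closed join_closed cmpl_closed one_closed zero_closed

lemma meet_idem:
  assumes x: "x \<in> carrier B"
  shows "meet B x x = x"
proof -
  have "meet B x x = join B (meet B x x) (meet B x (cmpl B x))"
    using x by (simp add: meet_cmpl join_zero closed)
  also have "\<dots> = meet B x (join B x (cmpl B x))"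
    using x by (simp add: meet_join_distrib closed)
  also have "\<dots> = x"
    using x by (simp add: join_cmpl meet_one)
  finally show ?thesis .
qed

lemma meet_zero:
  assumes x: "x \<in> carrier B"
  shows "meet B x (zero B) = zero B"
proof -
  have "meet B x (zero B) = meet B x (meet B x (cmpl B x))"
    using x by (simp add: meet_cmpl)
  also have "\<dots> = meet B (meet B x x) (cmpl B x)"
    using x by (simp add: meet_assoc closed)
  also have "\<dots> = zero B"
    using x by (simp add: meet_idem meet_cmpl)
  finally show ?thesis .
qed

lemma meet_join_absorb:
  assumes x: "x \<in> carrier B" and y: "y \<in> carrier B"
  shows "meet B x (join B x y) = x"
proof -
  have "meet B x (join B x y) = meet B (join B x (zero B)) (join B x y)"
    using x by (simp add: join_zero)
  also have "\<dots> = join B x (meet B y (zero B))"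
    using x y by (simp add: join_meet_distrib meet_commute closed)
  also have "\<dots> = x"
    using x y by (simp add: meet_zero join_zero)
  finally show ?thesis .
qed

lemma le_refl: "x \<in> carrier B \<Longrightarrow> le x x"
  by (simp add: le_def meet_idem)

lemma le_trans:
  "\<lbrakk>le x y; le y z; x \<in> carrier B; y \<in> carrier B; z \<in> carrier B\<rbrakk> \<Longrightarrow> le x z"
  unfolding le_def by (metis meet_assoc)

lemma le_antisym: "\<lbrakk>le x y; le y x; x \<in> carrier B; y \<in> carrier B\<rbrakk> \<Longrightarrow> x = y"
  unfolding le_def by (metis meet_commute)

lemma le_meet_iff:
  "\<lbrakk>x \<in> carrier B; y \<in> carrier B; z \<in> carrier B\<rbrakk> \<Longrightarrow> le x (meet B y z) \<longleftrightarrow> le x y \<and> le x z"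
  unfolding le_def by (metis closed meet_assoc meet_commute meet_idem)

lemma meet_le1: "\<lbrakk>x \<in> carrier B; y \<in> carrier B\<rbrakk> \<Longrightarrow> le (meet B x y) x"
  using le_meet_iff le_refl meet_closed by blast

lemma meet_le2: "\<lbrakk>x \<in> carrier B; y \<in> carrier B\<rbrakk> \<Longrightarrow> le (meet B x y) y"
  using le_meet_iff le_refl meet_closed by blast

lemma le_join1: "\<lbrakk>x \<in> carrier B; y \<in> carrier B\<rbrakk> \<Longrightarrow> le x (join B x y)"
  by (simp add: le_def meet_join_absorb)

lemma le_join2: "\<lbrakk>x \<in> carrier B; y \<in> carrier B\<rbrakk> \<Longrightarrow> le y (join B x y)"
  by (metis le_join1 join_commute)

lemma split_by_cmpl:
  "\<lbrakk>x \<in> carrier B; y \<in> carrier B\<rbrakk> \<Longrightarrow> join B (meet B x y) (meet B x (cmpl B y)) = x"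
  by (metis closed meet_join_distrib join_cmpl meet_one)

lemma le_iff_meet_cmpl:
  assumes "x \<in> carrier B" "y \<in> carrier B"
  shows "le x y \<longleftrightarrow> meet B x (cmpl B y) = zero B"
proof
  assume "le x y"
  then have "meet B x (cmpl B y) = meet B (meet B x y) (cmpl B y)"
    by (simp add: le_def)
  also have "\<dots> = zero B"
    using assms by (simp add: meet_assoc cmpl_closed meet_cmpl meet_zero)
  finally show "meet B x (cmpl B y) = zero B" .
next
  assume "meet B x (cmpl B y) = zero B"
  then show "le x y"
    unfolding le_def using split_by_cmpl[OF assms] assms by (simp add: join_zero closed)
qed

lemma le_zero_iff: "x \<in> carrier B \<Longrightarrow> le x (zero B) \<longleftrightarrow> x = zero B"
  unfolding le_def by (auto simp: meet_zero)

lemma le_one: "x \<in> carrier B \<Longrightarrow> le x (one B)"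
  by (simp add: le_def meet_one)

lemma atom_closed: "atom a \<Longrightarrow> a \<in> carrier B"
  by (simp add: atom_def)

lemma atom_not_le_iff: "\<lbrakk>atom a; x \<in> carrier B\<rbrakk> \<Longrightarrow> \<not> le a x \<longleftrightarrow> meet B a x = zero B"
  unfolding atom_def le_def by metis

lemma atom_not_le_zero: "atom a \<Longrightarrow> \<not> le a (zero B)"
  using atom_def le_zero_iff by blast

lemma atom_le_cmpl_iff:
  assumes "atom a" "x \<in> carrier B"
  shows "le a (cmpl B x) \<longleftrightarrow> \<not> le a x"
proof
  assume "le a (cmpl B x)"
  then show "\<not> le a x"
    by (metis assms atom_closed atom_not_le_zero closed(3) le_meet_iff meet_cmpl)
next
  assume "\<not> le a x"
  then have "meet B a x = zero B"
    using assms atom_not_le_iff by blast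
  then show "le a (cmpl B x)"
    unfolding le_def using split_by_cmpl[of a x] assms
    by (metis atom_closed closed(1,3,5) join_commute join_zero)
qed

lemma atom_le_join_iff:
  assumes "atom a" "x \<in> carrier B" "y \<in> carrier B"
  shows "le a (join B x y) \<longleftrightarrow> le a x \<or> le a y"
proof
  assume *: "le a (join B x y)"
  show "le a x \<or> le a y"
  proof (rule ccontr)
    assume "\<not> (le a x \<or> le a y)"
    then have "meet B a (join B x y) = zero B"
      using assms atom_not_le_iff
      by (metis atom_closed closed(5) join_zero meet_join_distrib)
    then show False
      using * assms(1) by (simp add: le_def atom_def)
  qed
next
  assume "le a x \<or> le a y"
  then show "le a (join B x y)"
    using le_trans le_join1 le_join2 atom_closed closed(2) assms by metis
qed

lemma atom_le_atom_iff: "\<lbrakk>atom a; atom b\<rbrakk> \<Longrightarrow> le a b \<longleftrightarrow> a = b"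
  by (metis atom_def le_antisym le_def le_refl meet_commute)

text \<open>
  By primality of atoms the join of \<open>J\<close> has no atoms below it other than those in \<open>J\<close>.
\<close>

lemma finite_set_of_atoms_realised:
  assumes "finite J" "\<forall>a\<in>J. atom a"
  shows "\<exists>x\<in>carrier B. \<forall>a. atom a \<longrightarrow> (le a x \<longleftrightarrow> a \<in> J)"
  using assms
proof (induction rule: finite_induct)
  case empty
  then show ?case
    using atom_not_le_zero zero_closed by auto
next
  case (insert b J)
  then obtain x where x: "x \<in> carrier B" "\<forall>a. atom a \<longrightarrow> (le a x \<longleftrightarrow> a \<in> J)"
    by auto
  have b: "atom b"
    using insert.prems by simp
  have "\<forall>a. atom a \<longrightarrow> (le a (join B b x) \<longleftrightarrow> a \<in> insert b J)"
    using x b by (simp add: atom_le_join_iff atom_closed atom_le_atom_iff)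
  then show ?case
    using x b atom_closed closed(2) by blast
qed

text \<open>
  Descent: an element that is neither \<open>zero\<close> nor an atom has a strictly smaller nonzero element below it.
\<close>

lemma atom_below_if_finite_downset:
  assumes "finite {y \<in> carrier B. le y x}" "x \<in> carrier B" "x \<noteq> zero B"
  shows "\<exists>a. atom a \<and> le a x"
  using assms
proof (induction "card {y \<in> carrier B. le y x}" arbitrary: x rule: less_induct)
  case (less x)
  show ?case
  proof (cases "atom x")
    case True
    then show ?thesis
      using less.prems le_refl by blast
  next
    case False
    then obtain z where z: "z \<in> carrier B" "meet B x z \<noteq> zero B" "meet B x z \<noteq> x"
      using less.prems atom_def by blast
    define y where "y = meet B x z"
    have y: "y \<in> carrier B" "le y x" "y \<noteq> zero B"
      using z less.prems by (auto simp: y_def closed meet_le1)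
    have "\<not> le x y"
      using le_antisym[of x y] y less.prems(2) z(3) y_def by auto
    then have "{u \<in> carrier B. le u y} \<subset> {u \<in> carrier B. le u x}"
      using y less.prems(2) le_trans le_refl by blast
    then obtain a where "atom a" "le a y"
      using less.hyps[of y] less.prems(1) y psubset_card_mono
      by (metis (no_types, lifting) finite_subset psubset_imp_subset)
    then show ?thesis
      using y less.prems(2) le_trans atom_closed by blast
  qed
qed

text \<open>
  If \<open>meet x c\<close> were not below \<open>y\<close>, then an atom below \<open>meet (meet x c) (cmpl y)\<close> would lie
  below \<open>c\<close> and \<open>x\<close> but not below \<open>y\<close>.
\<close>

lemma meet_eq_if_same_atoms:
  assumes fin: "finite {y \<in> carrier B. le y c}" and c: "c \<in> carrier B"
    and xy: "x \<in> carrier B" "y \<in> carrier B"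
    and same: "\<And>a. \<lbrakk>atom a; le a c\<rbrakk> \<Longrightarrow> le a x \<longleftrightarrow> le a y"
  shows "meet B x c = meet B y c"
proof -
  have below: "le (meet B x c) y"
    if x: "x \<in> carrier B" and y: "y \<in> carrier B"
      and same: "\<And>a. \<lbrakk>atom a; le a c\<rbrakk> \<Longrightarrow> le a x \<longleftrightarrow> le a y" for x y
  proof (rule ccontr)
    assume "\<not> le (meet B x c) y"
    define d where "d = meet B (meet B x c) (cmpl B y)"
    have d: "d \<in> carrier B" "d \<noteq> zero B"
      using \<open>\<not> le (meet B x c) y\<close> x y c le_iff_meet_cmpl by (auto simp: d_def closed)
    have "le d c"
      using d(1) x y c le_refl[of d] by (simp add: d_def le_meet_iff closed)
    then have "{u \<in> carrier B. le u d} \<subseteq> {u \<in> carrier B. le u c}"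
      using d(1) c le_trans by blast
    then have "finite {u \<in> carrier B. le u d}"
      using fin finite_subset by blast
    then obtain a where a: "atom a" "le a d"
      using atom_below_if_finite_downset d by blast
    then have "le a x" "le a c" "le a (cmpl B y)"
      using x y c by (simp_all add: d_def le_meet_iff atom_closed closed)
    then show False
      using a same y atom_le_cmpl_iff by blast
  qed
  have "le (meet B x c) (meet B y c)" "le (meet B y c) (meet B x c)"
    using below xy c same by (simp_all add: le_meet_iff closed meet_le2)
  then show ?thesis
    using le_antisym xy c closed by blast
qed

end

section \<open>Compact Boolean algebras\<close>

lemma continuous_map_into_discrete_if_fibres_open:
  assumes "\<And>x. x \<in> topspace T \<Longrightarrow> g x \<in> D"
    and "\<And>x. x \<in> topspace T \<Longrightarrow> openin T {y \<in> topspace T. g y = g x}"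
  shows "continuous_map T (discrete_topology D) g"
proof -
  have "openin T {x \<in> topspace T. g x \<in> U}" for U
  proof -
    have "{x \<in> topspace T. g x \<in> U} =
        (\<Union>x \<in> {x \<in> topspace T. g x \<in> U}. {y \<in> topspace T. g y = g x})"
      by auto
    also have "openin T \<dots>"
      using assms(2) by auto
    finally show ?thesis .
  qed
  then show ?thesis
    using assms(1) by (auto simp: continuous_map_def)
qed

lemma compact_space_indexed_fip:
  assumes "compact_space T" "I \<noteq> {}"
    and "\<And>i. i \<in> I \<Longrightarrow> closedin T (C i)"
    and "\<And>K. \<lbrakk>finite K; K \<subseteq> I; K \<noteq> {}\<rbrakk> \<Longrightarrow> (\<Inter>i\<in>K. C i) \<noteq> {}"
  shows "(\<Inter>i\<in>I. C i) \<noteq> {}"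
proof -
  have "\<Inter>\<F> \<noteq> {}" if \<F>: "finite \<F>" "\<F> \<subseteq> C ` I" for \<F>
  proof (cases "\<F> = {}")
    case False
    then show ?thesis
      using finite_subset_image[OF \<F>] assms(4) by (metis image_is_empty)
  qed simp
  then show ?thesis
    using assms(1,3) unfolding compact_space_fip by (metis imageE)
qed

locale compact_boolean_algebra = carrier_boolean_algebra B for B :: "'a bool_alg" +
  fixes T :: "'a topology"
  assumes compact: "compact_space T" and Hausdorff: "Hausdorff_space T"
    and topspace_eq: "topspace T = carrier B"
    and continuous_meet: "continuous_map (prod_topology T T) T (\<lambda>(x, y). meet B x y)"
    and continuous_join: "continuous_map (prod_topology T T) T (\<lambda>(x, y). join B x y)"
    and continuous_cmpl: "continuous_map T T (cmpl B)"
begin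

lemma continuous_map_meet:
  assumes "continuous_map U T f" "continuous_map U T g"
  shows "continuous_map U T (\<lambda>u. meet B (f u) (g u))"
  using continuous_map_compose[OF continuous_map_pairedI[OF assms] continuous_meet]
  by (simp add: o_def)

lemma continuous_map_join:
  assumes "continuous_map U T f" "continuous_map U T g"
  shows "continuous_map U T (\<lambda>u. join B (f u) (g u))"
  using continuous_map_compose[OF continuous_map_pairedI[OF assms] continuous_join]
  by (simp add: o_def)

lemma closedin_meet_eq:
  assumes "a \<in> carrier B" "b \<in> carrier B"
  shows "closedin T {x \<in> carrier B. meet B a x = b}"
proof -
  have "continuous_map T T (\<lambda>x. meet B a x)"
    by (rule continuous_map_meet) (use assms topspace_eq in auto)
  moreover have "closedin T {b}"
    using Hausdorff assms topspace_eq by (simp add: closedin_Hausdorff_sing_eq)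
  ultimately show ?thesis
    using closedin_continuous_map_preimage[of T T _ "{b}"] topspace_eq by simp
qed

text \<open>
  An atom \<open>a\<close> leaves only two values for \<open>meet a x\<close>, and both fibres are closed.  The flag \<open>P\<close>
  selects one of them, so that a set \<open>J\<close> of atoms can be prescribed by \<open>P = (a \<in> J)\<close>.
\<close>

lemma clopen_above_atom:
  assumes "atom a"
  shows "closedin T {x \<in> carrier B. le a x \<longleftrightarrow> P}" "openin T {x \<in> carrier B. le a x \<longleftrightarrow> P}"
proof -
  have a: "a \<in> carrier B"
    using assms atom_closed by blast
  have pos: "closedin T {x \<in> carrier B. le a x}"
    using closedin_meet_eq[OF a a] by (simp add: le_def)
  have "{x \<in> carrier B. \<not> le a x} = {x \<in> carrier B. meet B a x = zero B}"
    using assms atom_not_le_iff by blast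
  then have neg: "closedin T {x \<in> carrier B. \<not> le a x}"
    using closedin_meet_eq[OF a zero_closed] by simp
  show cl: "closedin T {x \<in> carrier B. le a x \<longleftrightarrow> P}" for P
    using pos neg by (cases P) auto
  have "{x \<in> carrier B. le a x \<longleftrightarrow> P} = topspace T - {x \<in> carrier B. le a x \<longleftrightarrow> \<not> P}"
    using topspace_eq by auto
  then show "openin T {x \<in> carrier B. le a x \<longleftrightarrow> P}"
    using cl[of "\<not> P"] by (simp add: openin_diff)
qed

lemma continuous_map_atoms_below:
  assumes "finite I" "\<And>i. i \<in> I \<Longrightarrow> atom (\<alpha> i)"
  shows "continuous_map T (discrete_topology (Pow I)) (\<lambda>x. {i \<in> I. le (\<alpha> i) x})"
proof (rule continuous_map_into_discrete_if_fibres_open)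
  fix x
  have "openin T (topspace T \<inter> (\<Inter>i\<in>I. {y \<in> carrier B. le (\<alpha> i) y \<longleftrightarrow> le (\<alpha> i) x}))"
    using assms clopen_above_atom(2) by (cases "I = {}") (auto intro!: openin_Int openin_INT2)
  moreover have "topspace T \<inter> (\<Inter>i\<in>I. {y \<in> carrier B. le (\<alpha> i) y \<longleftrightarrow> le (\<alpha> i) x}) =
      {y \<in> topspace T. {i \<in> I. le (\<alpha> i) y} = {i \<in> I. le (\<alpha> i) x}}"
    using topspace_eq by auto
  ultimately show "openin T {y \<in> topspace T. {i \<in> I. le (\<alpha> i) y} = {i \<in> I. le (\<alpha> i) x}}"
    by simp
qed auto

text \<open>
  Each atom imposes a closed condition on \<open>x\<close>, and finitely many conditions can be met by a finite join
  of atoms.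
\<close>

lemma set_of_atoms_realised:
  "\<exists>x\<in>carrier B. \<forall>a. atom a \<longrightarrow> (le a x \<longleftrightarrow> a \<in> J)"
proof (cases "Collect atom = {}")
  case True
  then show ?thesis
    using zero_closed by blast
next
  case False
  let ?C = "\<lambda>a. {x \<in> carrier B. le a x \<longleftrightarrow> a \<in> J}"
  have "(\<Inter>a\<in>Collect atom. ?C a) \<noteq> {}"
  proof (rule compact_space_indexed_fip[OF compact False])
    show "closedin T (?C a)" if "a \<in> Collect atom" for a
      using clopen_above_atom(1) that by simp
    show "(\<Inter>a\<in>K. ?C a) \<noteq> {}" if K: "finite K" "K \<subseteq> Collect atom" "K \<noteq> {}" for K
    proof -
      obtain x where "x \<in> carrier B" "\<forall>a. atom a \<longrightarrow> (le a x \<longleftrightarrow> a \<in> K \<inter> J)"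
        using finite_set_of_atoms_realised[of "K \<inter> J"] K by blast
      then have "x \<in> (\<Inter>a\<in>K. ?C a)"
        using K by auto
      then show ?thesis
        by blast
    qed
  qed
  then show ?thesis
    using False by auto
qed

text \<open>
  The elements that can be joined to any \<open>x\<close>, even after being shrunk, without changing the value of
  \<open>g\<close>.  Shrinking by \<open>y\<close> makes the set closed downwards; that \<open>x\<close> is arbitrary makes it closed under
  joins.
\<close>

definition null_ideal :: "('a \<Rightarrow> 'b) \<Rightarrow> 'a set" where
  "null_ideal g = {d \<in> carrier B. \<forall>x\<in>carrier B. \<forall>y\<in>carrier B. g (join B x (meet B d y)) = g x}"

lemma null_ideal_zero: "zero B \<in> null_ideal g"
  unfolding null_ideal_def using closed meet_zero meet_commute join_zero by auto

lemma null_ideal_join: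
  assumes "d \<in> null_ideal g" "e \<in> null_ideal g"
  shows "join B d e \<in> null_ideal g"
proof -
  have de: "d \<in> carrier B" "e \<in> carrier B"
    using assms by (auto simp: null_ideal_def)
  have "g (join B x (meet B (join B d e) y)) = g x" if "x \<in> carrier B" "y \<in> carrier B" for x y
  proof -
    have "meet B (join B d e) y = join B (meet B d y) (meet B e y)"
      using de that by (simp add: meet_commute[of _ y] meet_join_distrib closed)
    then have "join B x (meet B (join B d e) y) = join B (join B x (meet B d y)) (meet B e y)"
      using de that by (simp add: join_assoc closed)
    then show ?thesis
      using assms that de by (simp add: null_ideal_def closed)
  qed
  then show ?thesis
    using de by (simp add: null_ideal_def closed)
qed

lemma null_ideal_meet:
  assumes "d \<in> null_ideal g" "z \<in> carrier B"
  shows "meet B d z \<in> null_ideal g"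
  using assms by (simp add: null_ideal_def meet_assoc closed)

text \<open>
  The complement is the projection along a compact factor of the set \<open>N\<close> of violations, which is
  clopen because \<open>g\<close> takes values in a discrete space.  Projections are open, and projections along a
  compact factor are closed.
\<close>

lemma clopen_null_ideal:
  assumes "continuous_map T (discrete_topology D) g"
  shows "closedin T (null_ideal g)" "openin T (null_ideal g)"
proof -
  let ?P = "prod_topology T (prod_topology T T)"
  let ?G = "\<lambda>(d, x, y). (g (join B x (meet B d y)), g x)"
  define N where "N = {p \<in> topspace ?P. ?G p \<in> {(u, v). u \<noteq> v} \<inter> D \<times> D}"
  have "continuous_map ?P T (\<lambda>p. join B (fst (snd p)) (meet B (fst p) (snd (snd p))))"
    by (intro continuous_map_join continuous_map_meet continuous_map_fst
      continuous_map_compose[OF continuous_map_snd continuous_map_fst, unfolded o_def]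
      continuous_map_compose[OF continuous_map_snd continuous_map_snd, unfolded o_def])
  then have "continuous_map ?P (discrete_topology (D \<times> D)) ?G"
    unfolding prod_topology_discrete_topology case_prod_unfold
    by (intro continuous_map_pairedI continuous_map_compose[OF _ assms, unfolded o_def]
      continuous_map_compose[OF continuous_map_snd continuous_map_fst, unfolded o_def])
  then have N: "closedin ?P N" "openin ?P N"
    unfolding N_def
    by (rule closedin_continuous_map_preimage openin_continuous_map_preimage; simp)+
  have D: "g x \<in> D" if "x \<in> carrier B" for x
    using assms that topspace_eq by (auto simp: continuous_map_def)
  have eq: "null_ideal g = topspace T - fst ` N"
  proof -
    have "d \<in> null_ideal g \<longleftrightarrow> d \<notin> fst ` N" if "d \<in> carrier B" for d
      using that unfolding null_ideal_def N_def
      by (force simp: topspace_eq D closed image_iff)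
    then show ?thesis
      using topspace_eq by (auto simp: null_ideal_def)
  qed
  have "closedin T (fst ` N)"
    using closed_map_fst N(1) compact unfolding closed_map_def
    by (metis compact_space_prod_topology)
  moreover have "openin T (fst ` N)"
    using open_map_fst N(2) unfolding open_map_def by metis
  ultimately show "closedin T (null_ideal g)" "openin T (null_ideal g)"
    unfolding eq by auto
qed

text \<open>
  The ideal is closed and directed upwards, so by compactness it has a greatest element \<open>w\<close>.  It then
  consists of all elements below \<open>w\<close>, that is, disjoint from \<open>c = cmpl w\<close>.
\<close>

lemma null_ideal_principal:
  assumes "continuous_map T (discrete_topology D) g"
  obtains c where "c \<in> carrier B"
    "\<And>d. d \<in> carrier B \<Longrightarrow> d \<in> null_ideal g \<longleftrightarrow> meet B d c = zero B"
proof -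
  let ?W = "null_ideal g"
  have W: "?W \<subseteq> carrier B"
    by (auto simp: null_ideal_def)
  have "(\<Inter>d\<in>?W. ?W \<inter> {x \<in> carrier B. meet B d x = d}) \<noteq> {}"
  proof (rule compact_space_indexed_fip[OF compact])
    show "?W \<noteq> {}"
      using null_ideal_zero by blast
    show "closedin T (?W \<inter> {x \<in> carrier B. meet B d x = d})" if "d \<in> ?W" for d
      using clopen_null_ideal(1)[OF assms] closedin_meet_eq that W by blast
    show "(\<Inter>d\<in>K. ?W \<inter> {x \<in> carrier B. meet B d x = d}) \<noteq> {}"
      if "finite K" "K \<subseteq> ?W" "K \<noteq> {}" for K
    proof -
      have "\<exists>w\<in>?W. \<forall>d\<in>K. le d w"
        using that(1,2)
      proof (induction rule: finite_induct)
        case empty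
        then show ?case
          using null_ideal_zero by blast
      next
        case (insert d K)
        then obtain w where w: "w \<in> ?W" "\<forall>d\<in>K. le d w"
          by blast
        have "le e (join B d w)" if "e \<in> K" for e
        proof -
          have "d \<in> carrier B" "w \<in> carrier B" "e \<in> carrier B" "le e w"
            using w that insert.prems W by auto
          then show ?thesis
            using le_trans[of e w "join B d w"] le_join2 closed(2) by simp
        qed
        moreover have "le d (join B d w)"
          using le_join1[of d w] insert.prems w(1) W by auto
        ultimately have "\<forall>e\<in>insert d K. le e (join B d w)"
          by blast
        moreover have "join B d w \<in> ?W"
          using null_ideal_join insert.prems w(1) by blast
        ultimately show ?case
          by blast
      qed
      then obtain w where "w \<in> ?W" "\<forall>d\<in>K. le d w"
        by blast
      then have "w \<in> (\<Inter>d\<in>K. ?W \<inter> {x \<in> carrier B. meet B d x = d})"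
        using W by (auto simp: le_def)
      then show ?thesis
        by blast
    qed
  qed
  then obtain w where w_all: "w \<in> (\<Inter>d\<in>?W. ?W \<inter> {x \<in> carrier B. meet B d x = d})"
    by blast
  then have w: "w \<in> ?W" "\<And>d. d \<in> ?W \<Longrightarrow> le d w"
    using null_ideal_zero[of g] unfolding le_def by blast+
  then have w_closed: "w \<in> carrier B"
    using W by blast
  have "d \<in> ?W \<longleftrightarrow> meet B d (cmpl B w) = zero B" if d: "d \<in> carrier B" for d
  proof -
    have "d \<in> ?W" if "le d w"
      using null_ideal_meet[OF w(1) d] that meet_commute[OF w_closed d] by (simp add: le_def)
    then show ?thesis
      using w(2) le_iff_meet_cmpl[OF d w_closed] by blast
  qed
  then show ?thesis
    using that[of "cmpl B w"] cmpl_closed[OF w_closed] by blast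
qed

text \<open>
  Take \<open>c\<close> to be the complement of the greatest element of the null ideal.  If \<open>meet x c = meet y c\<close> then
  both differences of \<open>x\<close> and \<open>y\<close> lie in the ideal, so \<open>g x\<close> and \<open>g y\<close> both equal the value of \<open>g\<close>
  at \<open>meet x y\<close>.  The ideal is open, hence so are the fibres of \<open>x \<mapsto> meet x c\<close>, and by
  compactness there are only finitely many of them.
\<close>

lemma continuous_map_discrete_factors_finite:
  assumes g: "continuous_map T (discrete_topology D) g"
  obtains c where "c \<in> carrier B" "finite {y \<in> carrier B. le y c}"
    "\<forall>x\<in>carrier B. \<forall>y\<in>carrier B. meet B x c = meet B y c \<longrightarrow> g x = g y"
proof -
  let ?W = "null_ideal g"
  obtain c where c: "c \<in> carrier B"
    and W: "\<And>d. d \<in> carrier B \<Longrightarrow> d \<in> ?W \<longleftrightarrow> meet B d c = zero B"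
    using null_ideal_principal[OF g] by metis
  have diff: "meet B x (cmpl B y) \<in> ?W \<longleftrightarrow> le (meet B x c) y"
    if "x \<in> carrier B" "y \<in> carrier B" for x y
  proof -
    have "meet B (meet B x (cmpl B y)) c = meet B (meet B x c) (cmpl B y)"
      using that c by (simp add: meet_assoc meet_commute[of c] closed)
    then show ?thesis
      using W le_iff_meet_cmpl that c by (simp add: closed)
  qed
  have same: "meet B x c = meet B y c \<longleftrightarrow>
      meet B x (cmpl B y) \<in> ?W \<and> meet B y (cmpl B x) \<in> ?W"
    if "x \<in> carrier B" "y \<in> carrier B" for x y
  proof -
    have "le (meet B x c) y \<longleftrightarrow> le (meet B x c) (meet B y c)"
      "le (meet B y c) x \<longleftrightarrow> le (meet B y c) (meet B x c)"
      using that c by (simp_all add: le_meet_iff closed meet_le2)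
    moreover have "meet B x c = meet B y c \<longleftrightarrow>
        le (meet B x c) (meet B y c) \<and> le (meet B y c) (meet B x c)"
      using that c le_antisym[of "meet B x c" "meet B y c"] le_refl by (auto simp: closed)
    ultimately show ?thesis
      using diff that by simp
  qed
  show ?thesis
  proof
    show "c \<in> carrier B"
      by (rule c)
    have "continuous_map T (discrete_topology (carrier B)) (\<lambda>x. meet B x c)"
    proof (rule continuous_map_into_discrete_if_fibres_open)
      fix x
      assume "x \<in> topspace T"
      then have x: "x \<in> carrier B"
        by (simp add: topspace_eq)
      have "continuous_map T T (\<lambda>y. meet B y (cmpl B x))"
        by (intro continuous_map_meet) (use x topspace_eq closed in auto)
      then have 1: "openin T {y \<in> topspace T. meet B y (cmpl B x) \<in> ?W}"
        using clopen_null_ideal(2)[OF g] openin_continuous_map_preimage by blast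
      have "continuous_map T T (\<lambda>y. meet B x (cmpl B y))"
        by (intro continuous_map_meet continuous_cmpl) (use x topspace_eq in auto)
      then have 2: "openin T {y \<in> topspace T. meet B x (cmpl B y) \<in> ?W}"
        using clopen_null_ideal(2)[OF g] openin_continuous_map_preimage by blast
      have "{y \<in> topspace T. meet B y c = meet B x c} =
          {y \<in> topspace T. meet B y (cmpl B x) \<in> ?W} \<inter> {y \<in> topspace T. meet B x (cmpl B y) \<in> ?W}"
        using same x topspace_eq by auto
      then show "openin T {y \<in> topspace T. meet B y c = meet B x c}"
        using 1 2 by (simp add: openin_Int)
    qed (use c topspace_eq closed in auto)
    then have "compactin (discrete_topology (carrier B)) ((\<lambda>x. meet B x c) ` carrier B)"
      using image_compactin compact topspace_eq unfolding compact_space_def by metis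
    then have "finite ((\<lambda>x. meet B x c) ` carrier B)"
      by (simp add: compactin_discrete_topology)
    moreover have "{y \<in> carrier B. le y c} \<subseteq> (\<lambda>x. meet B x c) ` carrier B"
      by (force simp: le_def)
    ultimately show "finite {y \<in> carrier B. le y c}"
      by (rule rev_finite_subset)
    have drop: "g u = g (meet B u v)"
      if "u \<in> carrier B" "v \<in> carrier B" "meet B u (cmpl B v) \<in> ?W" for u v
    proof -
      have "\<forall>x\<in>carrier B. \<forall>y\<in>carrier B. g (join B x (meet B (meet B u (cmpl B v)) y)) = g x"
        using that(3) by (simp add: null_ideal_def)
      from this[THEN bspec, OF meet_closed[OF that(1,2)], THEN bspec, OF one_closed]
      have "g (join B (meet B u v) (meet B (meet B u (cmpl B v)) (one B))) = g (meet B u v)" .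
      then show ?thesis
        using that(1,2) by (simp add: split_by_cmpl meet_one closed)
    qed
    have "g x = g y"
      if xy: "x \<in> carrier B" "y \<in> carrier B" and eq: "meet B x c = meet B y c" for x y
    proof -
      have "g x = g (meet B x y)" "g y = g (meet B y x)"
        using same[OF xy] eq drop[OF xy] drop[OF xy(2,1)] by simp_all
      then show ?thesis
        using meet_commute[OF xy] by simp
    qed
    then show "\<forall>x\<in>carrier B. \<forall>y\<in>carrier B. meet B x c = meet B y c \<longrightarrow> g x = g y"
      by blast
  qed
qed

end

section \<open>Shift spaces and shift orbits\<close>

lemma topspace_shift_topology: "topspace (shift_topology A) = full_shift A"
  by (simp add: shift_topology_def full_shift_def PiE_UNIV_domain)

lemma Hausdorff_shift_topology: "Hausdorff_space (shift_topology A)"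
  by (simp add: shift_topology_def Hausdorff_space_product_topology)

lemma compact_space_shift_topology: "finite A \<Longrightarrow> compact_space (shift_topology A)"
  by (simp add: shift_topology_def compact_space_product_topology compact_space_discrete_topology)

lemma subshift_subset_full_shift: "subshift A Y \<Longrightarrow> Y \<subseteq> full_shift A"
  unfolding subshift_def using closedin_subset topspace_shift_topology by metis

lemma topspace_subshift_topology: "subshift A Y \<Longrightarrow> topspace (subshift_topology A Y) = Y"
  using subshift_subset_full_shift topspace_shift_topology by (metis inf.absorb_iff2 topspace_subtopology)

lemma compact_space_subshift_topology: "subshift A Y \<Longrightarrow> compact_space (subshift_topology A Y)"
  unfolding subshift_def
  by (simp add: closedin_compact_space compact_space_shift_topology compact_space_subtopology)

lemma continuous_map_into_shift_topology_iff:
  "continuous_map T (shift_topology A) f \<longleftrightarrow> (\<forall>n. continuous_map T (discrete_topology A) (\<lambda>x. f x n))"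
  by (simp add: shift_topology_def continuous_map_componentwise_UNIV)

lemma continuous_map_cell: "continuous_map (subshift_topology A Y) (discrete_topology A) (\<lambda>x. x n)"
  unfolding shift_topology_def
  by (intro continuous_map_from_subtopology continuous_map_product_projection) simp

definition shift_by :: "int \<Rightarrow> (int \<Rightarrow> 'a) \<Rightarrow> int \<Rightarrow> 'a" where
  "shift_by n x = (\<lambda>i. x (i + n))"

lemma shift_by_shift_by: "shift_by m (shift_by n x) = shift_by (m + n) x"
  by (simp add: shift_by_def add_ac)

lemma shift_by_0: "shift_by 0 x = x"
  by (simp add: shift_by_def)

lemma shift_eq_shift_by: "shift x = shift_by 1 x"
  by (simp add: shift_by_def shift_def)

lemma shift_by_inject: "shift_by n x = shift_by n y \<longleftrightarrow> x = y"
  by (metis add.left_inverse shift_by_0 shift_by_shift_by)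

text \<open>
  Negative shifts stay in \<open>X\<close> because \<open>shift\<close> maps \<open>X\<close> onto itself.
\<close>

lemma shift_by_closed:
  assumes "shift ` X = X" "x \<in> X"
  shows "shift_by n x \<in> X"
proof (induction n rule: int_induct[where k = 0])
  case base
  then show ?case
    using assms by (simp add: shift_by_0)
next
  case (step1 n)
  then have "shift (shift_by n x) \<in> X"
    using assms by blast
  then show ?case
    by (simp add: shift_eq_shift_by shift_by_shift_by add.commute)
next
  case (step2 n)
  then obtain y where y: "y \<in> X" "shift_by n x = shift y"
    using assms by blast
  then have "shift_by (-1) (shift_by n x) = y"
    by (simp add: shift_eq_shift_by shift_by_shift_by shift_by_0)
  then show ?case
    using y(1) by (simp add: shift_by_shift_by)
qed

lemma commutes_with_shift_by:
  assumes X: "shift ` X = X"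
    and g: "\<And>x y. \<lbrakk>x \<in> X; y \<in> X\<rbrakk> \<Longrightarrow> g (shift x) (shift y) = shift (g x y)"
    and xy: "x \<in> X" "y \<in> X"
  shows "g (shift_by n x) (shift_by n y) = shift_by n (g x y)"
proof (induction n rule: int_induct[where k = 0])
  case base
  then show ?case
    by (simp add: shift_by_0)
next
  case (step1 n)
  then show ?case
    using g[OF shift_by_closed[OF X xy(1)] shift_by_closed[OF X xy(2)], of n n]
    by (simp add: shift_eq_shift_by shift_by_shift_by add.commute)
next
  case (step2 n)
  have "shift (g (shift_by (n - 1) x) (shift_by (n - 1) y)) = shift (shift_by (n - 1) (g x y))"
    using g[OF shift_by_closed[OF X xy(1)] shift_by_closed[OF X xy(2)], of "n - 1" "n - 1"] step2
    by (simp add: shift_eq_shift_by shift_by_shift_by)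
  then show ?case
    by (simp add: shift_eq_shift_by shift_by_inject)
qed

definition orbit :: "(int \<Rightarrow> 'a) \<Rightarrow> (int \<Rightarrow> 'a) set" where
  "orbit x = range (\<lambda>n. shift_by n x)"

lemma shift_by_in_orbit: "shift_by n x \<in> orbit x"
  by (simp add: orbit_def)

lemma self_in_orbit: "x \<in> orbit x"
  using shift_by_in_orbit[of 0] by (simp add: shift_by_0)

lemma orbit_shift_by: "orbit (shift_by n x) = orbit x"
proof -
  have "orbit (shift_by n x) \<subseteq> orbit x" for n and x :: "int \<Rightarrow> 'a"
    by (auto simp: orbit_def shift_by_shift_by)
  from this[of n x] this[of "-n" "shift_by n x"] show ?thesis
    by (simp add: shift_by_shift_by shift_by_0)
qed

lemma orbit_eq_if_mem: "y \<in> orbit x \<Longrightarrow> orbit y = orbit x"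
  by (auto simp: orbit_shift_by orbit_def[of x])

lemma finite_orbit_if_periodic:
  assumes "shift_by p x = x" "p > 0"
  shows "finite (orbit x)"
proof -
  have cell: "x (i + p) = x i" for i
    using fun_cong[OF assms(1), of i] by (simp add: shift_by_def)
  have period: "x (i + k * p) = x i" for i k
  proof (induction k rule: int_induct[where k = 0])
    case (step1 k)
    then show ?case
      using cell[of "i + k * p"] by (simp add: algebra_simps)
  next
    case (step2 k)
    then show ?case
      using cell[of "i + (k - 1) * p"] by (simp add: algebra_simps)
  qed simp
  have "shift_by n x = shift_by (n mod p) x" for n
  proof
    fix i
    show "shift_by n x i = shift_by (n mod p) x i"
      using period[of "i + n mod p" "n div p"] by (simp add: shift_by_def add.assoc)
  qed
  then have "orbit x \<subseteq> (\<lambda>n. shift_by n x) ` {0..<p}"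
    unfolding orbit_def using assms(2) by (force simp: image_iff)
  then show ?thesis
    by (rule finite_subset) simp
qed

text \<open>
  The shift action of \<open>\<int>\<close> is free on an infinite orbit, since two equal shifts would give a
  period and a periodic point has a finite orbit.
\<close>

lemma infinite_orbit_free:
  assumes "infinite (orbit x)" "shift_by m x = shift_by n x"
  shows "m = n"
proof (rule ccontr)
  assume "m \<noteq> n"
  have "shift_by (m - n) x = x" "shift_by (n - m) x = x"
    using arg_cong[OF assms(2), of "shift_by (-n)"] arg_cong[OF assms(2), of "shift_by (-m)"]
    by (simp_all add: shift_by_shift_by shift_by_0)
  then show False
    using finite_orbit_if_periodic assms(1) \<open>m \<noteq> n\<close>
    by (metis diff_gt_0_iff_gt linorder_neqE)
qed

section \<open>Cellwise power set algebras\<close>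

text \<open>
  Subsets of the finite set \<open>R\<close> are coded by natural numbers, which serve as letters.
\<close>

locale cell_coding =
  fixes R :: "'s set" and code :: "'s set \<Rightarrow> nat"
  assumes finite_R: "finite R" and inj_code: "inj_on code (Pow R)"
begin

abbreviation alphabet :: "nat set" where
  "alphabet \<equiv> code ` Pow R"

definition decode :: "nat \<Rightarrow> 's set" where
  "decode = inv_into (Pow R) code"

lemma decode_code: "Q \<subseteq> R \<Longrightarrow> decode (code Q) = Q"
  by (simp add: decode_def inj_code)

lemma code_decode: "k \<in> alphabet \<Longrightarrow> code (decode k) = k"
  by (simp add: decode_def f_inv_into_f)

lemma decode_subset: "k \<in> alphabet \<Longrightarrow> decode k \<subseteq> R"
  using inv_into_into[of k code "Pow R"] by (simp add: decode_def)

text \<open>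
  The power set algebra of \<open>R\<close>, applied in each cell and restricted to the configurations in \<open>Y\<close>.
\<close>

definition cellwise :: "(int \<Rightarrow> nat) set \<Rightarrow> (int \<Rightarrow> nat) bool_alg" where
  "cellwise Y = \<lparr>
     carrier = Y,
     meet = (\<lambda>u v n. code (decode (u n) \<inter> decode (v n))),
     join = (\<lambda>u v n. code (decode (u n) \<union> decode (v n))),
     cmpl = (\<lambda>u n. code (R - decode (u n))),
     one = (\<lambda>n. code R),
     zero = (\<lambda>n. code {})\<rparr>"

lemma cellwise_simps [simp]:
  "carrier (cellwise Y) = Y"
  "meet (cellwise Y) = (\<lambda>u v n. code (decode (u n) \<inter> decode (v n)))"
  "join (cellwise Y) = (\<lambda>u v n. code (decode (u n) \<union> decode (v n)))"
  "cmpl (cellwise Y) = (\<lambda>u n. code (R - decode (u n)))"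
  "one (cellwise Y) = (\<lambda>n. code R)"
  "zero (cellwise Y) = (\<lambda>n. code {})"
  by (simp_all add: cellwise_def)

lemma continuous_cellwise_binary:
  assumes Y: "subshift A Y"
    and g: "\<And>p q. \<lbrakk>p \<in> A; q \<in> A\<rbrakk> \<Longrightarrow> g p q \<in> A"
    and closed: "\<And>u v. \<lbrakk>u \<in> Y; v \<in> Y\<rbrakk> \<Longrightarrow> (\<lambda>n. g (u n) (v n)) \<in> Y"
  shows "continuous_map (prod_topology (subshift_topology A Y) (subshift_topology A Y))
    (subshift_topology A Y) (\<lambda>(u, v) n. g (u n) (v n))"
proof -
  let ?T = "subshift_topology A Y"
  have "continuous_map (prod_topology ?T ?T) (discrete_topology A) (\<lambda>p. g (fst p n) (snd p n))" for n
  proof -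
    have pair: "continuous_map (prod_topology ?T ?T) (discrete_topology (A \<times> A)) (\<lambda>p. (fst p n, snd p n))"
      unfolding prod_topology_discrete_topology
      by (intro continuous_map_pairedI
          continuous_map_compose[OF continuous_map_fst continuous_map_cell, unfolded o_def]
          continuous_map_compose[OF continuous_map_snd continuous_map_cell, unfolded o_def])
    have "continuous_map (discrete_topology (A \<times> A)) (discrete_topology A) (\<lambda>(p, q). g p q)"
      using g by auto
    from continuous_map_compose[OF pair this] show ?thesis
      by (simp add: o_def)
  qed
  then show ?thesis
    unfolding continuous_map_in_subtopology continuous_map_into_shift_topology_iff
    using closed topspace_subshift_topology[OF Y] by (auto simp: case_prod_unfold)
qed

lemma boolean_algebraic_subshift_cellwise:
  assumes Y: "subshift alphabet Y"
    and meet: "\<And>u v. \<lbrakk>u \<in> Y; v \<in> Y\<rbrakk> \<Longrightarrow> meet (cellwise Y) u v \<in> Y"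
    and join: "\<And>u v. \<lbrakk>u \<in> Y; v \<in> Y\<rbrakk> \<Longrightarrow> join (cellwise Y) u v \<in> Y"
    and cmpl: "\<And>u. u \<in> Y \<Longrightarrow> cmpl (cellwise Y) u \<in> Y"
    and one: "one (cellwise Y) \<in> Y"
    and zero: "zero (cellwise Y) \<in> Y"
  shows "boolean_algebraic_subshift alphabet (cellwise Y)"
proof -
  have cell: "u n \<in> alphabet" if "u \<in> Y" for u n
    using subshift_subset_full_shift[OF Y] that by (auto simp: full_shift_def)
  have dec: "decode (u n) \<subseteq> R" "code (decode (u n)) = u n" if "u \<in> Y" for u n
    using cell[OF that] decode_subset code_decode by blast+
  have dec_code: "decode (code (decode (u n) \<inter> decode (v n))) = decode (u n) \<inter> decode (v n)"
    "decode (code (decode (u n) \<union> decode (v n))) = decode (u n) \<union> decode (v n)"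
    "decode (code (R - decode (u n))) = R - decode (u n)"
    if "u \<in> Y" "v \<in> Y" for u v n
    using dec[of u n] dec[of v n] that by (auto intro!: decode_code)
  have algebra: "carrier_boolean_algebra (cellwise Y)"
  proof unfold_locales
    fix x assume "x \<in> carrier (cellwise Y)"
    then have "decode (x n) \<inter> R = decode (x n)" "decode (x n) \<union> (R - decode (x n)) = R" for n
      using dec(1)[of x n] by auto
    then show "meet (cellwise Y) x (one (cellwise Y)) = x"
      "join (cellwise Y) x (cmpl (cellwise Y) x) = one (cellwise Y)"
      using \<open>x \<in> carrier (cellwise Y)\<close> by (simp_all add: dec dec_code decode_code)
  next
    show "meet (cellwise Y) (meet (cellwise Y) x y) z = meet (cellwise Y) x (meet (cellwise Y) y z)"
      "join (cellwise Y) (join (cellwise Y) x y) z = join (cellwise Y) x (join (cellwise Y) y z)"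
      "meet (cellwise Y) x (join (cellwise Y) y z) =
        join (cellwise Y) (meet (cellwise Y) x y) (meet (cellwise Y) x z)"
      "join (cellwise Y) x (meet (cellwise Y) y z) =
        meet (cellwise Y) (join (cellwise Y) x y) (join (cellwise Y) x z)"
      if "x \<in> carrier (cellwise Y)" "y \<in> carrier (cellwise Y)" "z \<in> carrier (cellwise Y)" for x y z
      using that
      by (simp_all add: dec_code Int_assoc Un_assoc Int_Un_distrib[of "decode _"]
          Un_Int_distrib[of "decode _" "decode _" "decode _"])
    show "meet (cellwise Y) x y = meet (cellwise Y) y x" "join (cellwise Y) x y = join (cellwise Y) y x"
      for x y
      by (simp_all add: Int_commute Un_commute)
    show "join (cellwise Y) x (zero (cellwise Y)) = x"
      "meet (cellwise Y) x (cmpl (cellwise Y) x) = zero (cellwise Y)"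
      if "x \<in> carrier (cellwise Y)" for x
      using that by (simp_all add: dec dec_code decode_code)
  qed (use meet join cmpl one zero in simp_all)
  have "continuous_map (subshift_topology alphabet Y) (subshift_topology alphabet Y)
      (\<lambda>u n. code (R - decode (u n)))"
  proof -
    let ?T = "subshift_topology alphabet Y"
    \<comment> \<open>The complement is a binary cellwise operation that ignores its second argument.\<close>
    have diag: "continuous_map ?T (prod_topology ?T ?T) (\<lambda>u. (u, u))"
      by (simp add: continuous_map_pairedI)
    have "continuous_map (prod_topology ?T ?T) ?T (\<lambda>(u, v) n. code (R - decode (u n)))"
      by (rule continuous_cellwise_binary[OF Y]) (use cmpl in auto)
    from continuous_map_compose[OF diag this] show ?thesis
      by (simp add: o_def)
  qed
  moreover have "continuous_map
      (prod_topology (subshift_topology alphabet Y) (subshift_topology alphabet Y))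
      (subshift_topology alphabet Y) (\<lambda>(u, v) n. code (decode (u n) \<inter> decode (v n)))"
    by (rule continuous_cellwise_binary[OF Y]) (use meet decode_subset in \<open>auto intro!: imageI\<close>)
  moreover have "continuous_map
      (prod_topology (subshift_topology alphabet Y) (subshift_topology alphabet Y))
      (subshift_topology alphabet Y) (\<lambda>(u, v) n. code (decode (u n) \<union> decode (v n)))"
    by (rule continuous_cellwise_binary[OF Y]) (use join decode_subset in \<open>auto intro!: imageI\<close>)
  ultimately show ?thesis
    unfolding boolean_algebraic_subshift_def block_map_def block_map2_def block_map0_def
    using Y algebra one zero by (simp add: shift_def)
qed

end

section \<open>Atoms of a Boolean algebraic subshift\<close>

text \<open>
  The part of the definition of a Boolean algebraic subshift that the action on atoms needs.  Since atoms
  and the order are defined from \<open>meet\<close> and \<open>zero\<close>, the shift has to preserve only these two.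
\<close>

locale boolean_subshift = compact_boolean_algebra X "subshift_topology S (carrier X)"
  for X :: "(int \<Rightarrow> 'a) bool_alg" and S :: "'a set" +
  assumes shift_image: "shift ` carrier X = carrier X"
    and meet_shift: "\<lbrakk>x \<in> carrier X; y \<in> carrier X\<rbrakk>
      \<Longrightarrow> meet X (shift x) (shift y) = shift (meet X x y)"
    and shift_zero: "shift (zero X) = zero X"

lemma boolean_subshift_if_boolean_algebraic_subshift:
  assumes "boolean_algebraic_subshift S X"
  shows "boolean_subshift X S"
proof -
  have X: "subshift S (carrier X)"
    using assms by (simp add: boolean_algebraic_subshift_def)
  interpret carrier_boolean_algebra X
    using assms by (simp add: boolean_algebraic_subshift_def)
  show ?thesis
  proof
    show "compact_space (subshift_topology S (carrier X))"
      by (rule compact_space_subshift_topology[OF X])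
    show "Hausdorff_space (subshift_topology S (carrier X))"
      by (simp add: Hausdorff_space_subtopology Hausdorff_shift_topology)
    show "topspace (subshift_topology S (carrier X)) = carrier X"
      by (rule topspace_subshift_topology[OF X])
  qed (use assms in \<open>simp_all add: boolean_algebraic_subshift_def subshift_def
      block_map_def block_map2_def block_map0_def\<close>)
qed

context boolean_subshift
begin

lemma shift_by_mem: "x \<in> carrier X \<Longrightarrow> shift_by n x \<in> carrier X"
  by (rule shift_by_closed[OF shift_image])

lemma shift_by_meet:
  "\<lbrakk>x \<in> carrier X; y \<in> carrier X\<rbrakk> \<Longrightarrow> meet X (shift_by n x) (shift_by n y) = shift_by n (meet X x y)"
  by (rule commutes_with_shift_by[where g = "meet X", OF shift_image meet_shift])

lemma shift_by_zero: "shift_by n (zero X) = zero X"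
  using commutes_with_shift_by[of "carrier X" "\<lambda>_ _. zero X"] shift_image shift_zero zero_closed
  by metis

lemma le_shift_by_iff:
  assumes "x \<in> carrier X" "y \<in> carrier X"
  shows "le (shift_by n x) (shift_by n y) \<longleftrightarrow> le x y"
  using assms by (simp add: le_def shift_by_meet shift_by_inject)

lemma atom_shift_by:
  assumes "atom a"
  shows "atom (shift_by n a)"
proof -
  have a: "a \<in> carrier X"
    by (rule atom_closed[OF assms])
  have "meet X (shift_by n a) x = zero X \<or> meet X (shift_by n a) x = shift_by n a"
    if x: "x \<in> carrier X" for x
  proof -
    let ?y = "shift_by (-n) x"
    have "x = shift_by n ?y"
      by (simp add: shift_by_shift_by shift_by_0)
    then have "meet X (shift_by n a) x = shift_by n (meet X a ?y)"
      using shift_by_meet[OF a shift_by_mem[OF x, of "-n"], of n] by simp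
    moreover have "meet X a ?y = zero X \<or> meet X a ?y = a"
      using assms shift_by_mem[OF x] by (simp add: atom_def)
    ultimately show ?thesis
      using shift_by_zero by metis
  qed
  moreover have "shift_by n a \<noteq> zero X"
    using assms shift_by_zero[of n] shift_by_inject[of n a "zero X"] by (simp add: atom_def)
  ultimately show ?thesis
    using shift_by_mem[OF a] by (simp add: atom_def)
qed

text \<open>
  Shifting \<open>a\<close> by \<open>-n\<close> is the same as shifting \<open>x\<close> by \<open>n\<close> when the order is tested, so cell \<open>n\<close>
  shows the atoms of \<open>R\<close> below \<open>shift_by n x\<close>.  In this form every cell is a statement about atoms below
  the one element \<open>x\<close>.
\<close>

definition itinerary :: "((int \<Rightarrow> 'a) set \<Rightarrow> nat) \<Rightarrow> (int \<Rightarrow> 'a) set \<Rightarrow> (int \<Rightarrow> 'a) \<Rightarrow> int \<Rightarrow> nat" where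
  "itinerary code R x = (\<lambda>n. code {a \<in> R. le (shift_by (-n) a) x})"

lemma itinerary_shift:
  assumes "\<forall>a\<in>R. atom a" "x \<in> carrier X"
  shows "itinerary code R (shift x) = shift (itinerary code R x)"
proof
  fix n
  have "le (shift_by (-n) a) (shift x) \<longleftrightarrow> le (shift_by (-(n + 1)) a) x" if "a \<in> R" for a
    using le_shift_by_iff[of "shift_by (-(n + 1)) a" x 1] assms that atom_closed shift_by_mem
    by (simp add: shift_eq_shift_by shift_by_shift_by)
  then have "{a \<in> R. le (shift_by (-n) a) (shift x)} = {a \<in> R. le (shift_by (-(n + 1)) a) x}"
    by blast
  then show "itinerary code R (shift x) n = shift (itinerary code R x) n"
    by (simp add: itinerary_def shift_def)
qed

end

locale coded_atoms = boolean_subshift X S + cell_coding R code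
  for X :: "(int \<Rightarrow> 'a) bool_alg" and S :: "'a set"
    and R :: "(int \<Rightarrow> 'a) set" and code :: "(int \<Rightarrow> 'a) set \<Rightarrow> nat" +
  assumes atoms: "\<forall>a\<in>R. atom a"
begin

abbreviation \<Phi> :: "(int \<Rightarrow> 'a) \<Rightarrow> int \<Rightarrow> nat" where
  "\<Phi> \<equiv> itinerary code R"

abbreviation itineraries :: "(int \<Rightarrow> nat) set" where
  "itineraries \<equiv> \<Phi> ` carrier X"

lemma itinerary_in_full_shift: "\<Phi> x \<in> full_shift alphabet"
  by (auto simp: itinerary_def full_shift_def)

lemma decode_itinerary: "decode (\<Phi> x n) = {a \<in> R. le (shift_by (-n) a) x}"
  by (auto simp: itinerary_def intro!: decode_code)

lemma itinerary_eq_iff: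
  "\<Phi> x = \<Phi> y \<longleftrightarrow> (\<forall>a\<in>R. \<forall>n. le (shift_by n a) x \<longleftrightarrow> le (shift_by n a) y)"
proof
  assume eq: "\<Phi> x = \<Phi> y"
  have "le (shift_by n a) x \<longleftrightarrow> le (shift_by n a) y" if "a \<in> R" for a n
    using decode_itinerary[of x "-n"] decode_itinerary[of y "-n"] eq that by auto
  then show "\<forall>a\<in>R. \<forall>n. le (shift_by n a) x \<longleftrightarrow> le (shift_by n a) y"
    by blast
next
  assume "\<forall>a\<in>R. \<forall>n. le (shift_by n a) x \<longleftrightarrow> le (shift_by n a) y"
  then have "{a \<in> R. le (shift_by (-n) a) x} = {a \<in> R. le (shift_by (-n) a) y}" for n
    by blast
  then show "\<Phi> x = \<Phi> y"
    by (simp add: itinerary_def)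
qed

lemma continuous_map_itinerary:
  "continuous_map (subshift_topology S (carrier X)) (shift_topology alphabet) \<Phi>"
  unfolding continuous_map_into_shift_topology_iff
proof
  fix n
  have sets: "continuous_map (subshift_topology S (carrier X)) (discrete_topology (Pow R))
      (\<lambda>x. {a \<in> R. le (shift_by (-n) a) x})"
    by (rule continuous_map_atoms_below) (use finite_R atoms atom_shift_by in auto)
  have "continuous_map (discrete_topology (Pow R)) (discrete_topology alphabet) code"
    by auto
  from continuous_map_compose[OF sets this]
  show "continuous_map (subshift_topology S (carrier X)) (discrete_topology alphabet) (\<lambda>x. \<Phi> x n)"
    by (simp add: itinerary_def o_def)
qed

text \<open>
  The set of itineraries is compact as a continuous image, hence closed.
\<close>

lemma subshift_itineraries: "subshift alphabet itineraries"
proof -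
  have "compactin (shift_topology alphabet) itineraries"
    using image_compactin[OF _ continuous_map_itinerary] compact topspace_eq
    unfolding compact_space_def by metis
  then have "closedin (shift_topology alphabet) itineraries"
    by (rule compactin_imp_closedin[OF Hausdorff_shift_topology])
  moreover have "shift ` itineraries = itineraries"
  proof -
    have "shift ` itineraries = \<Phi> ` shift ` carrier X"
      using itinerary_shift[OF atoms] by (auto simp: image_image)
    then show ?thesis
      by (simp add: shift_image)
  qed
  ultimately show ?thesis
    using finite_R by (simp add: subshift_def)
qed

lemma atom_shift_by_R: "a \<in> R \<Longrightarrow> atom (shift_by n a)"
  using atoms atom_shift_by by blast

text \<open>
  The operations of the target do not depend on its carrier, so \<open>C\<close> is arbitrary.
\<close>

lemma itinerary_meet:
  "\<lbrakk>x \<in> carrier X; y \<in> carrier X\<rbrakk> \<Longrightarrow> \<Phi> (meet X x y) = meet (cellwise C) (\<Phi> x) (\<Phi> y)"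
  by (rule ext, simp add: decode_itinerary, simp add: itinerary_def)
    (rule arg_cong[of _ _ code], auto simp: le_meet_iff atom_closed atom_shift_by_R)

lemma itinerary_join:
  "\<lbrakk>x \<in> carrier X; y \<in> carrier X\<rbrakk> \<Longrightarrow> \<Phi> (join X x y) = join (cellwise C) (\<Phi> x) (\<Phi> y)"
  by (rule ext, simp add: decode_itinerary, simp add: itinerary_def)
    (rule arg_cong[of _ _ code], auto simp: atom_le_join_iff atom_shift_by_R)

lemma itinerary_cmpl: "x \<in> carrier X \<Longrightarrow> \<Phi> (cmpl X x) = cmpl (cellwise C) (\<Phi> x)"
  by (rule ext, simp add: decode_itinerary, simp add: itinerary_def)
    (rule arg_cong[of _ _ code], auto simp: atom_le_cmpl_iff atom_shift_by_R)

lemma itinerary_one: "\<Phi> (one X) = one (cellwise C)"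
  by (rule ext, simp add: itinerary_def)
    (rule arg_cong[of _ _ code], auto simp: le_one atom_closed atom_shift_by_R)

lemma itinerary_zero: "\<Phi> (zero X) = zero (cellwise C)"
  by (rule ext, simp add: itinerary_def)
    (rule arg_cong[of _ _ code], auto simp: atom_not_le_zero atom_shift_by_R)

lemma boolean_algebraic_subshift_itineraries:
  "boolean_algebraic_subshift alphabet (cellwise itineraries)"
proof (rule boolean_algebraic_subshift_cellwise[OF subshift_itineraries])
  show "meet (cellwise itineraries) u v \<in> itineraries" "join (cellwise itineraries) u v \<in> itineraries" if uv: "u \<in> itineraries" "v \<in> itineraries" for u v
  proof -
    obtain x y where x: "x \<in> carrier X" "u = \<Phi> x" and y: "y \<in> carrier X" "v = \<Phi> y"
      using uv by blast
    show "meet (cellwise itineraries) u v \<in> itineraries"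
      unfolding x(2) y(2) itinerary_meet[OF x(1) y(1), symmetric]
      by (rule imageI[OF meet_closed[OF x(1) y(1)]])
    show "join (cellwise itineraries) u v \<in> itineraries"
      unfolding x(2) y(2) itinerary_join[OF x(1) y(1), symmetric]
      by (rule imageI[OF join_closed[OF x(1) y(1)]])
  qed
  show "cmpl (cellwise itineraries) u \<in> itineraries" if u: "u \<in> itineraries" for u
  proof -
    obtain x where x: "x \<in> carrier X" "u = \<Phi> x"
      using u by blast
    show ?thesis
      unfolding x(2) itinerary_cmpl[OF x(1), symmetric]
      by (rule imageI[OF cmpl_closed[OF x(1)]])
  qed
  show "one (cellwise itineraries) \<in> itineraries"
    unfolding itinerary_one[symmetric] by (rule imageI[OF one_closed])
  show "zero (cellwise itineraries) \<in> itineraries"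
    unfolding itinerary_zero[symmetric] by (rule imageI[OF zero_closed])
qed

text \<open>
  The pairs of an atom \<open>a\<close> in \<open>R\<close> and a position \<open>n\<close> give pairwise distinct atoms \<open>shift_by (-n) a\<close>, so
  any configuration of subsets of \<open>R\<close> prescribes a well-defined set of atoms, which some \<open>x\<close>
  realises.
\<close>

lemma itineraries_eq_full_shift:
  assumes infinite: "\<forall>a\<in>R. infinite (orbit a)"
    and distinct: "\<forall>a\<in>R. \<forall>b\<in>R. orbit a = orbit b \<longrightarrow> a = b"
  shows "itineraries = full_shift alphabet"
proof
  have free: "a = b \<and> m = n" if "a \<in> R" "b \<in> R" "shift_by m a = shift_by n b" for a b m n
  proof -
    have "orbit a = orbit b"
      using orbit_shift_by[of m a] orbit_shift_by[of n b] that(3) by simp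
    then have "a = b"
      using distinct that(1,2) by blast
    then show ?thesis
      using infinite_orbit_free[of b m n] infinite that by simp
  qed
  show "itineraries \<subseteq> full_shift alphabet"
    using itinerary_in_full_shift by blast
  show "full_shift alphabet \<subseteq> itineraries"
  proof
    fix y assume y: "y \<in> full_shift alphabet"
    then have cell: "y n \<in> alphabet" for n
      by (auto simp: full_shift_def)
    define J where "J = {shift_by (-n) a |a n. a \<in> decode (y n)}"
    obtain x where x: "x \<in> carrier X" "\<forall>a. atom a \<longrightarrow> (le a x \<longleftrightarrow> a \<in> J)"
      using set_of_atoms_realised by blast
    have "{a \<in> R. le (shift_by (-n) a) x} = decode (y n)" for n
    proof -
      have "shift_by (-n) a \<in> J \<longleftrightarrow> a \<in> decode (y n)" if a: "a \<in> R" for a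
      proof
        assume "shift_by (-n) a \<in> J"
        then obtain b m where b: "shift_by (-n) a = shift_by (-m) b" "b \<in> decode (y m)"
          by (auto simp: J_def)
        then have "b \<in> R"
          using decode_subset[OF cell] by blast
        then show "a \<in> decode (y n)"
          using free[OF a _ b(1)] b(2) by simp
      qed (auto simp: J_def)
      then show ?thesis
        using x(2) atom_shift_by_R decode_subset[OF cell[of n]] by auto
    qed
    then have "\<Phi> x = y"
      by (simp add: itinerary_def code_decode[OF cell])
    then show "y \<in> itineraries"
      using x(1) by blast
  qed
qed

text \<open>
  The itinerary of \<open>x\<close> depends only on the atoms below \<open>x\<close> in the orbits of \<open>R\<close>, which form a
  finite set.
\<close>

lemma finite_itineraries:
  assumes "\<forall>a\<in>R. finite (orbit a)"
  shows "finite itineraries"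
proof -
  let ?I = "\<Union>a\<in>R. orbit a"
  let ?G = "\<lambda>J n. code {a \<in> R. shift_by (-n) a \<in> J}"
  have "itineraries \<subseteq> ?G ` Pow ?I"
  proof (rule image_subsetI)
    fix x
    let ?J = "{i \<in> ?I. le i x}"
    have "shift_by (-n) a \<in> ?J \<longleftrightarrow> le (shift_by (-n) a) x" if "a \<in> R" for a n
      using shift_by_in_orbit[of "-n" a] that by auto
    then have "{a \<in> R. le (shift_by (-n) a) x} = {a \<in> R. shift_by (-n) a \<in> ?J}" for n
      by blast
    then have "\<Phi> x = ?G ?J"
      by (simp add: itinerary_def)
    then show "\<Phi> x \<in> ?G ` Pow ?I"
      by (rule image_eqI) blast
  qed
  moreover have "finite (Pow ?I)"
    using finite_R assms by simp
  ultimately show ?thesis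
    using finite_surj by blast
qed

end

context boolean_subshift
begin

section \<open>Decomposition into infinite and finite orbits\<close>

definition separating :: "(int \<Rightarrow> 'a) set \<Rightarrow> bool" where
  "separating F \<longleftrightarrow> (\<forall>x\<in>carrier X. \<forall>y\<in>carrier X.
     (\<forall>a\<in>F. \<forall>n. le (shift_by n a) x \<longleftrightarrow> le (shift_by n a) y) \<longrightarrow> x = y)"

text \<open>
  Which atoms of some finite set lie below \<open>x\<close> determines the cell \<open>x 0\<close>.  Applied to \<open>shift_by n x\<close>, this
  shows that the shifts of the same atoms determine \<open>x n\<close>.
\<close>

lemma finite_separating_set_of_atoms:
  obtains F where "finite F" "\<forall>a\<in>F. atom a" "separating F"
proof -
  obtain c where c: "c \<in> carrier X" "finite {y \<in> carrier X. le y c}"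
    and cell: "\<forall>x\<in>carrier X. \<forall>y\<in>carrier X. meet X x c = meet X y c \<longrightarrow> x 0 = y 0"
    by (rule continuous_map_discrete_factors_finite[OF continuous_map_cell])
  define F where "F = {a. atom a \<and> le a c}"
  show ?thesis
  proof
    show "finite F"
      using c(2) by (rule rev_finite_subset) (auto simp: F_def atom_closed)
    show "\<forall>a\<in>F. atom a"
      by (simp add: F_def)
    show "separating F"
      unfolding separating_def
    proof (intro ballI impI ext)
      fix x y n
      assume x: "x \<in> carrier X" and y: "y \<in> carrier X"
        and same: "\<forall>a\<in>F. \<forall>n. le (shift_by n a) x \<longleftrightarrow> le (shift_by n a) y"
      have "le a (shift_by n x) \<longleftrightarrow> le a (shift_by n y)" if "atom a" "le a c" for a
      proof -
        have "le a (shift_by n z) \<longleftrightarrow> le (shift_by (-n) a) z" if "z \<in> carrier X" for z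
          using le_shift_by_iff[OF shift_by_mem[OF atom_closed[OF \<open>atom a\<close>], of "-n"] that, of n]
          by (simp add: shift_by_shift_by shift_by_0)
        from this[OF x] this[OF y] show ?thesis
          using same that by (simp add: F_def)
      qed
      then have "meet X (shift_by n x) c = meet X (shift_by n y) c"
        by (rule meet_eq_if_same_atoms[OF c(2,1) shift_by_mem[OF x] shift_by_mem[OF y]])
      then have "shift_by n x 0 = shift_by n y 0"
        using cell shift_by_mem[OF x, of n] shift_by_mem[OF y, of n] by simp
      then show "x n = y n"
        by (simp add: shift_by_def)
    qed
  qed
qed

text \<open>
  Only the orbits of the separating atoms matter.  In the infinite ones a single representative is kept, so that
  distinct positions carry distinct atoms; the finite ones may be kept as they are.
\<close>

lemma separating_orbit_representatives:
  obtains P Q where "finite P" "finite Q" "\<forall>a\<in>P \<union> Q. atom a"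
    "\<forall>a\<in>P. infinite (orbit a)" "\<forall>a\<in>Q. finite (orbit a)"
    "\<forall>a\<in>P. \<forall>b\<in>P. orbit a = orbit b \<longrightarrow> a = b" "separating (P \<union> Q)"
proof -
  obtain F where F: "finite F" "\<forall>a\<in>F. atom a" "separating F"
    by (rule finite_separating_set_of_atoms)
  define Q where "Q = {a \<in> F. finite (orbit a)}"
  \<comment> \<open>The choice depends on the orbit only, so atoms with the same orbit have the same representative.\<close>
  define rep where "rep O' = (SOME b. b \<in> F \<and> b \<in> O')" for O' :: "(int \<Rightarrow> 'a) set"
  define P where "P = (\<lambda>a. rep (orbit a)) ` (F - Q)"
  have "rep (orbit a) \<in> F \<and> rep (orbit a) \<in> orbit a" if "a \<in> F" for a
    unfolding rep_def by (rule someI[of _ a]) (simp add: that self_in_orbit)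
  then have rep: "rep (orbit a) \<in> F" "rep (orbit a) \<in> orbit a" if "a \<in> F" for a
    using that by simp_all
  have rep_orbit: "orbit (rep (orbit a)) = orbit a" if "a \<in> F" for a
    using rep(2)[OF that] by (rule orbit_eq_if_mem)
  show ?thesis
  proof
    show "finite P" "finite Q"
      using F(1) by (auto simp: P_def Q_def)
    show "\<forall>a\<in>P \<union> Q. atom a"
      using F(2) rep(1) by (auto simp: P_def Q_def)
    show "\<forall>a\<in>Q. finite (orbit a)"
      by (simp add: Q_def)
    show "\<forall>a\<in>P. infinite (orbit a)"
      by (simp add: P_def Q_def rep_orbit)
    show "\<forall>a\<in>P. \<forall>b\<in>P. orbit a = orbit b \<longrightarrow> a = b"
      by (simp add: P_def rep_orbit)
    have same_on_F: "le (shift_by n a) x \<longleftrightarrow> le (shift_by n a) y"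
      if a: "a \<in> F" and same: "\<forall>b\<in>P \<union> Q. \<forall>n. le (shift_by n b) x \<longleftrightarrow> le (shift_by n b) y"
      for a n x y
    proof (cases "a \<in> Q")
      case False
      then have "rep (orbit a) \<in> P"
        using a by (simp add: P_def)
      have "a \<in> orbit (rep (orbit a))"
        unfolding rep_orbit[OF a] by (rule self_in_orbit)
      then obtain k where "a = shift_by k (rep (orbit a))"
        unfolding orbit_def[of "rep (orbit a)"] by (rule rangeE)
      then have "shift_by n a = shift_by (n + k) (rep (orbit a))"
        using shift_by_shift_by[of n k "rep (orbit a)"] by simp
      then show ?thesis
        using same \<open>rep (orbit a) \<in> P\<close> by simp
    qed (use same in blast)
    show "separating (P \<union> Q)"
      unfolding separating_def
    proof (intro ballI impI)
      fix x y
      assume xy: "x \<in> carrier X" "y \<in> carrier X"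
        and same: "\<forall>b\<in>P \<union> Q. \<forall>n. le (shift_by n b) x \<longleftrightarrow> le (shift_by n b) y"
      have "\<forall>a\<in>F. \<forall>n. le (shift_by n a) x \<longleftrightarrow> le (shift_by n a) y"
        using same_on_F[OF _ same] by blast
      then show "x = y"
        using F(3) xy unfolding separating_def by blast
    qed
  qed
qed

end

lemma coding_exists:
  assumes "finite R"
  obtains code :: "'s set \<Rightarrow> nat" where "cell_coding R code"
  using finite_imp_inj_to_nat_seg[of "Pow R"] assms by (auto simp: cell_coding_def)

lemma fst_pair_seq [simp]: "fst \<circ> pair_seq y z = y"
  and snd_pair_seq [simp]: "snd \<circ> pair_seq y z = z"
  by (auto simp: pair_seq_def)

theorem corollary4:
  fixes S :: "'a set" and X :: "(int \<Rightarrow> 'a) bool_alg"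
  assumes "boolean_algebraic_subshift S X"
  shows "\<exists>(A :: nat set) (B :: nat set) Y Z f.
    boolean_algebraic_subshift A Y \<and> carrier Y = full_shift A \<and>
    boolean_algebraic_subshift B Z \<and> finite (carrier Z) \<and>
    algebraic_conjugacy S X (A \<times> B) (prod_bool_alg Y Z) f"
proof -
  interpret boolean_subshift X S
    by (rule boolean_subshift_if_boolean_algebraic_subshift[OF assms])
  obtain P Q where fin: "finite P" "finite Q" and atoms: "\<forall>a\<in>P \<union> Q. atom a"
    and infinite_orbit: "\<forall>a\<in>P. infinite (orbit a)" and finite_orbit: "\<forall>a\<in>Q. finite (orbit a)"
    and distinct_orbits: "\<forall>a\<in>P. \<forall>b\<in>P. orbit a = orbit b \<longrightarrow> a = b"
    and separating: "separating (P \<union> Q)"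
    by (rule separating_orbit_representatives)
  obtain c where "cell_coding P c"
    using coding_exists[OF fin(1)] .
  then interpret P: cell_coding P c .
  interpret P: coded_atoms X S P c
    by unfold_locales (use atoms in blast)
  obtain d where "cell_coding Q d"
    using coding_exists[OF fin(2)] .
  then interpret Q: cell_coding Q d .
  interpret Q: coded_atoms X S Q d
    by unfold_locales (use atoms in blast)
  let ?\<Phi> = "itinerary c P" and ?\<Psi> = "itinerary d Q"
  define Y where "Y = P.cellwise (?\<Phi> ` carrier X)"
  define Z where "Z = Q.cellwise (?\<Psi> ` carrier X)"
  define f where "f x = pair_seq (?\<Phi> x) (?\<Psi> x)" for x
  have carriers: "carrier Y = ?\<Phi> ` carrier X" "carrier Z = ?\<Psi> ` carrier X"
    by (simp_all add: Y_def Z_def)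
  have range: "f ` carrier X = carrier (prod_bool_alg Y Z)"
  proof -
    have "\<exists>x\<in>carrier X. ?\<Phi> x = ?\<Phi> y \<and> ?\<Psi> x = ?\<Psi> z" for y z
    proof -
      \<comment> \<open>The two factors see disjoint sets of atoms, told apart by the size of the orbit.  Hence
        the atoms below \<open>x\<close> may be taken from \<open>y\<close> on one side and from \<open>z\<close> on the other.\<close>
      let ?J = "{a. if finite (orbit a) then le a z else le a y}"
      obtain x where x: "x \<in> carrier X" and le_x: "\<forall>a. atom a \<longrightarrow> (le a x \<longleftrightarrow> a \<in> ?J)"
        using set_of_atoms_realised[of ?J] by blast
      have "?\<Phi> x = ?\<Phi> y"
        using le_x P.atom_shift_by_R infinite_orbit by (simp add: P.itinerary_eq_iff orbit_shift_by)
      moreover have "?\<Psi> x = ?\<Psi> z"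
        using le_x Q.atom_shift_by_R finite_orbit by (simp add: Q.itinerary_eq_iff orbit_shift_by)
      ultimately show ?thesis
        using x by blast
    qed
    then have "pair_seq (?\<Phi> y) (?\<Psi> z) \<in> f ` carrier X" for y z
      unfolding f_def by (metis (no_types, lifting) imageI)
    then show ?thesis
      by (auto simp: prod_bool_alg_def carriers f_def)
  qed
  have inj: "inj_on f (carrier X)"
  proof (rule inj_onI)
    fix x y assume xy: "x \<in> carrier X" "y \<in> carrier X" "f x = f y"
    have "fst \<circ> f x = fst \<circ> f y" "snd \<circ> f x = snd \<circ> f y"
      using xy(3) by simp_all
    then have "?\<Phi> x = ?\<Phi> y" "?\<Psi> x = ?\<Psi> y"
      by (simp_all add: f_def)
    then have "\<forall>a\<in>P \<union> Q. \<forall>n. le (shift_by n a) x \<longleftrightarrow> le (shift_by n a) y"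
      unfolding P.itinerary_eq_iff Q.itinerary_eq_iff by blast
    then show "x = y"
      using separating xy(1,2) unfolding separating_def by blast
  qed
  have "continuous_map (subshift_topology S (carrier X))
      (subshift_topology (P.alphabet \<times> Q.alphabet) (carrier (prod_bool_alg Y Z))) f"
    unfolding continuous_map_in_subtopology continuous_map_into_shift_topology_iff
      prod_topology_discrete_topology
  proof (intro conjI allI)
    show "continuous_map (subshift_topology S (carrier X))
        (prod_topology (discrete_topology P.alphabet) (discrete_topology Q.alphabet)) (\<lambda>x. f x n)" for n
      using P.continuous_map_itinerary Q.continuous_map_itinerary
      unfolding continuous_map_into_shift_topology_iff f_def pair_seq_def
      by (intro continuous_map_pairedI) auto
    show "f \<in> topspace (subshift_topology S (carrier X)) \<rightarrow> carrier (prod_bool_alg Y Z)"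
      using range topspace_eq by auto
  qed
  moreover have "f (shift x) = shift (f x)" if "x \<in> carrier X" for x
    using itinerary_shift that P.atoms Q.atoms by (simp add: f_def pair_seq_def shift_def)
  moreover have "bool_alg_hom X (prod_bool_alg Y Z) f"
    unfolding bool_alg_hom_def
  proof (intro conjI)
    show "f ` carrier X \<subseteq> carrier (prod_bool_alg Y Z)"
      by (simp add: range)
  qed (simp_all add: prod_bool_alg_def f_def Y_def Z_def pair_seq_def
      P.itinerary_meet[of _ _ "?\<Phi> ` carrier X"] Q.itinerary_meet[of _ _ "?\<Psi> ` carrier X"]
      P.itinerary_join[of _ _ "?\<Phi> ` carrier X"] Q.itinerary_join[of _ _ "?\<Psi> ` carrier X"]
      P.itinerary_cmpl[of _ "?\<Phi> ` carrier X"] Q.itinerary_cmpl[of _ "?\<Psi> ` carrier X"]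
      P.itinerary_one[of "?\<Phi> ` carrier X"] Q.itinerary_one[of "?\<Psi> ` carrier X"]
      P.itinerary_zero[of "?\<Phi> ` carrier X"] Q.itinerary_zero[of "?\<Psi> ` carrier X"])
  ultimately have "algebraic_conjugacy S X (P.alphabet \<times> Q.alphabet) (prod_bool_alg Y Z) f"
    using range inj
    by (simp add: algebraic_conjugacy_def conjugacy_def block_map_def bij_betw_def)
  moreover have "boolean_algebraic_subshift P.alphabet Y" "boolean_algebraic_subshift Q.alphabet Z"
    unfolding Y_def Z_def
    by (rule P.boolean_algebraic_subshift_itineraries Q.boolean_algebraic_subshift_itineraries)+
  moreover have "carrier Y = full_shift P.alphabet" "finite (carrier Z)"
    unfolding carriers by (rule P.itineraries_eq_full_shift[OF infinite_orbit distinct_orbits] Q.finite_itineraries[OF finite_orbit])+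
  ultimately show ?thesis
    by (intro exI conjI)
qed

end
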